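(* Let $\alpha>0$ be real. Then $$\sum_{i,j\ge0}\frac{q^{2\alpha i^2+4(1-\alpha)ij+2\alpha j^2+(2\alpha-1)(i-j)}}{(q;q)_{2i+1}(q;q)_{2j}}=\frac{(-q,-q^{4\alpha-1},q^{4\alpha};q^{4\alpha})_{\infty}}{(q;q)_\infty},$$ $$\sum_{i,j\ge0}\frac{q^{2 \alpha i^2+4(1-\alpha)ij+2\alpha j^2+2\alpha i+(2-2 \alpha)j}}{(q;q)_{2i+1}(q;q)_{2j}}=\frac{(q^{8\alpha};q^{8\alpha})_\infty^2}{(q;q)_\infty(q^{4\alpha};q^{4\alpha})_\infty}.$$
   Context: Write $q=e^{2\pi i\tau}$ with $\operatorname{Im}\tau>0$ and $q^x:=e^{2\pi i\tau x}$ for real $x$. For $|q|<1$: $(a;q)_\infty=\prod_{k\ge0}(1-aq^k)$ (similarly $(a;q^{\beta})_\infty=\prod_{k\ge0}(1-aq^{\beta k})$ for $\beta>0$); for integers $n\ge0$, $(a;q)_n=\prod_{k=0}^{n-1}(1-aq^k)$; and $(a_1,\dots,a_m;p)_\infty=\prod_{k=1}^m(a_k;p)_\infty$. *)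

theory Defs
  imports "HOL-Analysis.Analysis"
begin

(* q^x for real x, where q = exp (2 * pi * i * tau); the branch is fixed by tau,
   so this is not the principal-branch power "q powr x". *)
definition qpow :: "complex \<Rightarrow> real \<Rightarrow> complex" where
  "qpow \<tau> x = exp (2 * of_real pi * \<i> * \<tau> * of_real x)"

definition qpoch :: "complex \<Rightarrow> complex \<Rightarrow> nat \<Rightarrow> complex" where
  "qpoch a p n = (\<Prod>k<n. 1 - a * p ^ k)"

(* Meaningful for norm p < 1. The value is 0 if some factor vanishes: prodinf is the
   limit of the partial products in that case as well. For p = qpow tau beta, p ^ k is
   q^(beta * k), so this also covers the symbols to the base q^beta. *)
definition qpoch_inf :: "complex \<Rightarrow> complex \<Rightarrow> complex" where
  "qpoch_inf a p = (\<Prod>k. 1 - a * p ^ k)"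

definition qpoch_inf_list :: "complex list \<Rightarrow> complex \<Rightarrow> complex" where
  "qpoch_inf_list as p = (\<Prod>a\<leftarrow>as. qpoch_inf a p)"

end

theory Submission
  imports Defs
begin

text \<open>
  Put \<open>m = 2 i + 1\<close> and \<open>n = 2 j\<close>. Both summands then become symmetric functions of \<open>(m, n)\<close>, so each
  double sum is half of the sum over all \<open>(m, n)\<close> with \<open>m - n\<close> odd. By the Durfee rectangle identity
  the weights \<open>q\<^sup>m\<^sup>n / ((q; q)\<^sub>m (q; q)\<^sub>n)\<close> have the same sum \<open>1 / (q; q)\<^sub>\<infinity>\<close> along every diagonal
  \<open>m - n = d\<close>; what remains is a theta series in \<open>d\<close>, evaluated by the Jacobi triple product.
  The triple product itself follows from the same identity and Euler's expansion of \<open>(- x; q)\<^sub>\<infinity>\<close>.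
\<close>

section \<open>Finite and infinite q-Pochhammer symbols\<close>

lemma qpoch_Suc: "qpoch a p (Suc n) = qpoch a p n * (1 - a * p ^ n)"
  by (simp add: qpoch_def)

lemma convergent_prod_qpoch:
  fixes a p :: complex
  assumes "norm p < 1"
  shows "convergent_prod (\<lambda>k. 1 - a * p ^ k)"
proof -
  have "summable (\<lambda>k. norm a * norm p ^ k)"
    using assms by (intro summable_mult summable_geometric) auto
  then show ?thesis
    by (intro abs_convergent_prod_imp_convergent_prod summable_imp_abs_convergent_prod)
       (simp add: norm_mult norm_power)
qed

lemma qpoch_LIMSEQ: "norm p < 1 \<Longrightarrow> qpoch a p \<longlonglongrightarrow> qpoch_inf a p"
  using convergent_prod_LIMSEQ[OF convergent_prod_qpoch, of p a]
  by (simp add: qpoch_def[abs_def] qpoch_inf_def LIMSEQ_lessThan_iff_atMost)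

lemma qpoch_self_factor_nonzero:
  fixes p :: complex
  assumes "norm p < 1"
  shows "1 - p * p ^ k \<noteq> 0"
proof
  assume "1 - p * p ^ k = 0"
  then have "norm (p ^ Suc k) = 1" by (simp flip: power_Suc)
  moreover have "norm p ^ Suc k < 1"
    using power_Suc_less_one[of "norm p" k] assms by (cases "p = 0") auto
  ultimately show False by (simp add: norm_power norm_mult)
qed

lemma qpoch_self_nonzero: "norm p < 1 \<Longrightarrow> qpoch p p n \<noteq> 0"
  using qpoch_self_factor_nonzero by (simp add: qpoch_def)

lemma qpoch_inf_self_nonzero: "norm p < 1 \<Longrightarrow> qpoch_inf p p \<noteq> 0"
  unfolding qpoch_inf_def
  by (intro prodinf_nonzero convergent_prod_qpoch qpoch_self_factor_nonzero)

text \<open>The reciprocals converge because the limit \<open>qpoch_inf p p\<close> is nonzero. In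
  the majorants below the denominators therefore cost only a constant.\<close>

lemma inverse_qpoch_bounded:
  assumes "norm p < 1"
  obtains K where "K > 0" "\<And>n. norm (1 / qpoch p p n) \<le> K"
proof -
  have "(\<lambda>n. 1 / qpoch p p n) \<longlonglongrightarrow> 1 / qpoch_inf p p"
    by (intro tendsto_intros qpoch_LIMSEQ qpoch_inf_self_nonzero assms)
  then have "Bseq (\<lambda>n. 1 / qpoch p p n)"
    by (intro convergent_imp_Bseq) (auto simp: convergent_def)
  then show ?thesis
    using that unfolding Bseq_def by blast
qed

section \<open>The Durfee rectangle identity and sums along diagonals\<close>

text \<open>This is the generating function of the partitions whose Durfee rectangle, for the fixed
  difference \<open>n - m\<close> of the sides, is \<open>m\<close> by \<open>n\<close>. Each
  partition has exactly one such rectangle on each diagonal.\<close>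

definition durfee_term :: "complex \<Rightarrow> nat \<Rightarrow> nat \<Rightarrow> complex" where
  "durfee_term q m n = q ^ (m * n) / (qpoch q q m * qpoch q q n)"

lemma durfee_term_bound:
  assumes "norm q < 1"
  obtains K where "K > 0" "\<And>m n. norm (durfee_term q m n) \<le> K * norm q ^ (m * n)"
proof -
  obtain K where K: "K > 0" "\<And>n. norm (1 / qpoch q q n) \<le> K"
    using inverse_qpoch_bounded[OF assms] by blast
  have "norm (durfee_term q m n) \<le> K\<^sup>2 * norm q ^ (m * n)" for m n
  proof -
    have "norm (durfee_term q m n)
        = norm q ^ (m * n) * (norm (1 / qpoch q q m) * norm (1 / qpoch q q n))"
      by (simp add: durfee_term_def norm_divide norm_mult norm_power)
    also have "\<dots> \<le> norm q ^ (m * n) * (K * K)"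
      using K by (intro mult_left_mono mult_mono) (auto intro: less_imp_le)
    finally show ?thesis by (simp add: power2_eq_square mult_ac)
  qed
  with K(1) show ?thesis by (intro that[of "K\<^sup>2"]) auto
qed

lemma summable_durfee_term:
  assumes "norm q < 1"
  shows "summable (\<lambda>k. norm (durfee_term q k (k + e)))"
proof -
  obtain K where K: "K > 0" "\<And>m n. norm (durfee_term q m n) \<le> K * norm q ^ (m * n)"
    using durfee_term_bound[OF assms] by blast
  have "norm (norm (durfee_term q k (k + e))) \<le> K * norm q ^ k" for k
  proof -
    have "norm q ^ (k * (k + e)) \<le> norm q ^ k"
      using assms by (intro power_decreasing) (auto simp: distrib_left intro: trans_le_add1)
    with K(1) K(2)[of k "k + e"] show ?thesis
      by (smt (verit) mult_left_mono norm_ge_zero real_norm_def)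
  qed
  moreover have "summable (\<lambda>k. K * norm q ^ k)"
    using assms by (intro summable_mult summable_geometric) auto
  ultimately show ?thesis by (rule summable_comparison_test'[where N = 0, rotated])
qed

text \<open>The argument is analytic. The diagonal sum \<open>F e\<close> is bounded and tends to
  \<open>1 / qpoch_inf q q\<close> as \<open>e\<close> grows, and a three-term recurrence together
  with boundedness forces \<open>F\<close> to be constant.\<close>

lemma durfee_rectangle:
  assumes q: "norm q < 1"
  shows "(\<lambda>k. durfee_term q k (k + e)) sums (1 / qpoch_inf q q)"
proof -
  define F where "F e = (\<Sum>k. durfee_term q k (k + e))" for e
  have sm: "summable (\<lambda>k. durfee_term q k (k + e))" for e
    using summable_durfee_term[OF q] by (rule summable_norm_cancel)
  obtain K where K: "K > 0" "\<And>m n. norm (durfee_term q m n) \<le> K * norm q ^ (m * n)"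
    using durfee_term_bound[OF q] by blast
  define M where "M = K / (1 - norm q)"
  have geo: "(\<lambda>k. K * norm q ^ k) sums M"
    using q sums_mult[OF geometric_sums[of "norm q"], of K] by (simp add: M_def)
  have M: "M > 0" using K q by (simp add: M_def)
  \<comment> \<open>The \<open>k = 0\<close> term of \<open>F e\<close> is exactly
    \<open>1 / qpoch q q e\<close>; every later term carries at least the factor
    \<open>q ^ e\<close>.\<close>
  have F_approx: "norm (F e - 1 / qpoch q q e) \<le> norm q ^ e * M" for e
  proof -
    have "F e = (\<Sum>k. durfee_term q (Suc k) (Suc k + e)) + durfee_term q 0 (0 + e)"
      unfolding F_def using suminf_split_head[OF sm[of e]] by simp
    then have "F e - 1 / qpoch q q e = (\<Sum>k. durfee_term q (Suc k) (Suc k + e))"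
      by (simp add: durfee_term_def qpoch_def)
    moreover have "norm (\<Sum>k. durfee_term q (Suc k) (Suc k + e)) \<le> (\<Sum>k. norm q ^ e * (K * norm q ^ k))"
    proof (rule norm_suminf_le)
      fix k
      have "k + e \<le> Suc k * (Suc k + e)" by simp
      then have "norm q ^ (Suc k * (Suc k + e)) \<le> norm q ^ (k + e)"
        using q by (intro power_decreasing) auto
      then show "norm (durfee_term q (Suc k) (Suc k + e)) \<le> norm q ^ e * (K * norm q ^ k)"
        using K(1) order_trans[OF K(2)[of "Suc k" "Suc k + e"] mult_left_mono[of _ "norm q ^ (k + e)" K]]
        by (simp add: power_add mult_ac del: mult_Suc mult_Suc_right add_Suc)
    next
      show "summable (\<lambda>k. norm q ^ e * (K * norm q ^ k))"
        using geo by (intro summable_mult sums_summable)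
    qed
    moreover have "(\<Sum>k. norm q ^ e * (K * norm q ^ k)) = norm q ^ e * M"
      using sums_mult[OF geo] by (simp add: sums_iff)
    ultimately show ?thesis by simp
  qed
  have F_bound: "norm (F e) \<le> K + M" for e
  proof -
    have "norm (1 / qpoch q q e) \<le> K"
      using K(2)[of 0 e] by (simp add: durfee_term_def qpoch_def)
    moreover have "norm q ^ e * M \<le> M"
      using q M by (simp add: mult_left_le_one_le power_le_one)
    ultimately show ?thesis
      using F_approx[of e] norm_triangle_sub[of "F e" "1 / qpoch q q e"] by simp
  qed
  \<comment> \<open>The recurrence makes the differences of \<open>F\<close> grow geometrically unless they vanish.\<close>
  have step: "F e - F (Suc e) = q ^ Suc e * (F (Suc (Suc e)) - F (Suc e))" for e
  proof -
    \<comment> \<open>Over the common denominator the numerators differ by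
      \<open>q ^ (k * (k + e))\<close> times \<open>(1 - q ^ k) - q ^ (k + e + 1)\<close>;
      \<open>?t\<close> is the part with \<open>1 - q ^ k\<close>. That factor makes
      \<open>?t 0\<close> vanish, and in \<open>?t (Suc k)\<close> it cancels the last factor of the
      first denominator, which leaves a term of the diagonal \<open>e + 2\<close>.\<close>
    let ?t = "\<lambda>k. (1 - q ^ k) * q ^ (k * (k + e)) / (qpoch q q k * qpoch q q (Suc (k + e)))"
    have diff: "durfee_term q k (k + e) - durfee_term q k (k + Suc e)
        = ?t k - q ^ Suc e * durfee_term q k (k + Suc e)" for k
    proof -
      have "durfee_term q k (k + e)
          = q ^ (k * (k + e)) * (1 - q * q ^ (k + e)) / (qpoch q q k * qpoch q q (Suc (k + e)))"
        using qpoch_self_factor_nonzero[OF q, of "k + e"]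
        by (simp add: durfee_term_def qpoch_Suc)
      moreover have "durfee_term q k (k + Suc e)
          = q ^ (k * (k + e)) * q ^ k / (qpoch q q k * qpoch q q (Suc (k + e)))"
        by (simp add: durfee_term_def power_add mult_ac)
      ultimately show ?thesis
        by (simp add: diff_divide_distrib[symmetric] power_add algebra_simps)
    qed
    have lhs: "(\<lambda>k. durfee_term q k (k + e) - durfee_term q k (k + Suc e)) sums (F e - F (Suc e))"
      unfolding F_def by (intro sums_diff summable_sums sm)
    have "(\<lambda>k. q ^ Suc e * durfee_term q k (k + Suc (Suc e))) sums (q ^ Suc e * F (Suc (Suc e)))"
      unfolding F_def by (intro sums_mult summable_sums sm)
    moreover have "q ^ Suc e * durfee_term q k (k + Suc (Suc e)) = ?t (Suc k)" for k
      using qpoch_self_factor_nonzero[OF q, of k]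
      by (simp add: durfee_term_def qpoch_Suc[of q q k] power_add mult_ac)
    ultimately have "(\<lambda>k. ?t (Suc k)) sums (q ^ Suc e * F (Suc (Suc e)))"
      by simp
    then have "?t sums (q ^ Suc e * F (Suc (Suc e)))"
      by (subst (asm) sums_Suc_iff) simp
    moreover have "(\<lambda>k. q ^ Suc e * durfee_term q k (k + Suc e)) sums (q ^ Suc e * F (Suc e))"
      unfolding F_def by (intro sums_mult summable_sums sm)
    ultimately have "(\<lambda>k. durfee_term q k (k + e) - durfee_term q k (k + Suc e)) sums
        (q ^ Suc e * F (Suc (Suc e)) - q ^ Suc e * F (Suc e))"
      unfolding diff by (rule sums_diff)
    from sums_unique2[OF lhs this] show ?thesis by (simp add: right_diff_distrib)
  qed
  have contract: "norm (F e - F (Suc e)) \<le> norm q * norm (F (Suc e) - F (Suc (Suc e)))" for e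
  proof -
    have "norm (F e - F (Suc e)) = norm q ^ Suc e * norm (F (Suc e) - F (Suc (Suc e)))"
      by (subst step) (simp add: norm_mult norm_power norm_minus_commute)
    also have "\<dots> \<le> norm q ^ 1 * norm (F (Suc e) - F (Suc (Suc e)))"
      using q by (intro mult_right_mono power_decreasing) auto
    finally show ?thesis by simp
  qed
  have iter: "norm (F e - F (Suc e)) \<le> norm q ^ n * norm (F (e + n) - F (Suc (e + n)))" for e n
  proof (induction n)
    case (Suc n)
    have "norm q ^ n * norm (F (e + n) - F (Suc (e + n)))
        \<le> norm q ^ n * (norm q * norm (F (Suc (e + n)) - F (Suc (Suc (e + n)))))"
      by (intro mult_left_mono contract) auto
    with Suc show ?case by (simp add: mult_ac)
  qed simp
  have F_Suc: "F e = F (Suc e)" for e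
  proof -
    have "norm (F e - F (Suc e)) \<le> norm q ^ n * (2 * (K + M))" for n
    proof -
      have "norm (F (e + n) - F (Suc (e + n))) \<le> 2 * (K + M)"
        using norm_triangle_ineq4[of "F (e + n)" "F (Suc (e + n))"]
          F_bound[of "e + n"] F_bound[of "Suc (e + n)"] by simp
      then show ?thesis
        using order_trans[OF iter[of e n] mult_left_mono] by simp
    qed
    moreover have "(\<lambda>n. norm q ^ n * (2 * (K + M))) \<longlonglongrightarrow> 0 * (2 * (K + M))"
      using q by (intro tendsto_mult_right LIMSEQ_realpow_zero) auto
    ultimately have "norm (F e - F (Suc e)) \<le> 0"
      by (intro LIMSEQ_le_const[where X = "\<lambda>n. norm q ^ n * (2 * (K + M))"]) auto
    then show ?thesis by simp
  qed
  have F_const: "F e = F 0" for e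
    by (induction e) (use F_Suc in auto)
  have "(\<lambda>e. norm q ^ e * M) \<longlonglongrightarrow> 0 * M"
    using q by (intro tendsto_mult_right LIMSEQ_realpow_zero) auto
  then have "(\<lambda>e. norm q ^ e * M) \<longlonglongrightarrow> 0" by simp
  then have "(\<lambda>e. F e - 1 / qpoch q q e) \<longlonglongrightarrow> 0"
    by (rule Lim_null_comparison[rotated]) (use F_approx in auto)
  moreover have "(\<lambda>e. 1 / qpoch q q e) \<longlonglongrightarrow> 1 / qpoch_inf q q"
    by (intro tendsto_intros qpoch_LIMSEQ qpoch_inf_self_nonzero q)
  ultimately have "(\<lambda>e. F e - 1 / qpoch q q e + 1 / qpoch q q e) \<longlonglongrightarrow> 0 + 1 / qpoch_inf q q"
    by (rule tendsto_add)
  moreover have "F = (\<lambda>_. F 0)" using F_const by (rule ext)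
  ultimately have "(\<lambda>e::nat. F 0) \<longlonglongrightarrow> 1 / qpoch_inf q q"
    by simp
  then have "F 0 = 1 / qpoch_inf q q"
    using LIMSEQ_const_iff by blast
  then show ?thesis
    using summable_sums[OF sm[of e]] F_const[of e] by (simp add: F_def)
qed

text \<open>A weight that depends only on \<open>m - n\<close> is constant on each diagonal, and
  every diagonal has the same sum. Absolute convergence allows summing diagonal by diagonal.\<close>

lemma has_sum_durfee_weighted:
  fixes c :: "int \<Rightarrow> complex"
  assumes q: "norm q < 1" and c: "(c has_sum C) UNIV"
  shows "((\<lambda>(m, n). c (int m - int n) * durfee_term q m n) has_sum (C / qpoch_inf q q)) UNIV"
proof -
  \<comment> \<open>The coordinates are \<open>d = m - n\<close> and \<open>k = min m n\<close>, so
    \<open>?v d\<close> runs through the diagonal \<open>d\<close> for either sign of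
    \<open>d\<close>.\<close>
  let ?v = "\<lambda>d k. durfee_term q (k + nat d) (k + nat (- d))"
  have v: "?v d k = durfee_term q k (k + nat \<bar>d\<bar>)" for d k
    by (cases "d \<ge> 0") (simp_all add: durfee_term_def mult_ac)
  have v_sum: "(?v d has_sum (1 / qpoch_inf q q)) UNIV" for d
    unfolding v by (intro norm_summable_imp_has_sum summable_durfee_term durfee_rectangle q)
  obtain K where K: "K > 0" "\<And>m n. norm (durfee_term q m n) \<le> K * norm q ^ (m * n)"
    using durfee_term_bound[OF q] by blast
  \<comment> \<open>The bound is uniform in \<open>d\<close>, so the double series is dominated by a
    product of two convergent series.\<close>
  have v_bound: "norm (?v d k) \<le> K * norm q ^ k" for d k
  proof -
    have "norm q ^ (k * (k + nat \<bar>d\<bar>)) \<le> norm q ^ k"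
      using q by (intro power_decreasing) (auto simp: distrib_left intro: trans_le_add1)
    with K(1) show ?thesis
      unfolding v by (intro order_trans[OF K(2) mult_left_mono]) auto
  qed
  have abs_c: "(\<lambda>d. norm (c d)) summable_on UNIV"
    using c summable_on_iff_abs_summable_on_complex has_sum_imp_summable by blast
  have "(\<lambda>(d, k). norm (c d) * (K * norm q ^ k)) summable_on UNIV \<times> UNIV"
  proof (rule summable_on_SigmaI)
    have "(\<lambda>k. K * norm q ^ k) sums (K * (1 / (1 - norm q)))"
      using q by (intro sums_mult geometric_sums) auto
    then have "((\<lambda>k. K * norm q ^ k) has_sum (K * (1 / (1 - norm q)))) UNIV"
      using K(1) by (intro sums_nonneg_imp_has_sum) auto
    then show "((\<lambda>k. case (d, k) of (d, k) \<Rightarrow> norm (c d) * (K * norm q ^ k)) has_sum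
        norm (c d) * (K * (1 / (1 - norm q)))) UNIV" for d
      by (simp only: prod.case has_sum_cmult_right)
    show "(\<lambda>d. norm (c d) * (K * (1 / (1 - norm q)))) summable_on UNIV"
      by (rule summable_on_cmult_left[OF abs_c])
  qed (use K in auto)
  then have "(\<lambda>x. norm (case x of (d, k) \<Rightarrow> c d * ?v d k)) summable_on UNIV \<times> UNIV"
    by (rule Infinite_Sum.abs_summable_on_comparison_test')
       (auto simp: norm_mult intro!: mult_left_mono v_bound)
  then have "(\<lambda>(d, k). c d * ?v d k) summable_on UNIV \<times> UNIV"
    by (rule abs_summable_summable)
  then have "((\<lambda>(d, k). c d * ?v d k) has_sum (C * (1 / qpoch_inf q q))) (UNIV \<times> UNIV)"
    by (rule has_sum_SigmaI[rotated 2])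
       (auto intro!: has_sum_cmult_right has_sum_cmult_left v_sum c
             simp del: times_divide_eq_right mult_1_right)
  moreover have "((\<lambda>(d, k). c d * ?v d k) has_sum S) (UNIV \<times> UNIV) \<longleftrightarrow>
      ((\<lambda>(m, n). c (int m - int n) * durfee_term q m n) has_sum S) UNIV" for S
    by (rule has_sum_reindex_bij_witness[where
          j = "\<lambda>(d, k). (k + nat d, k + nat (- d))" and
          i = "\<lambda>(m, n). (int m - int n, min m n)"]) (auto simp: min_def)
  ultimately show ?thesis by simp
qed

section \<open>Euler's expansion of an infinite product\<close>

text \<open>The power series \<open>E\<close> satisfies \<open>E y = (1 + y) * E (y * p)\<close>.
  Iterating this splits off the factors of the product one at a time, while the remaining argument
  \<open>x * p ^ n\<close> tends to 0, where \<open>E\<close> is continuous with value 1.\<close>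

lemma euler_qexp:
  assumes p: "norm p < 1"
  shows "((\<lambda>k. p ^ (k choose 2) * x ^ k / qpoch p p k) has_sum qpoch_inf (- x) p) UNIV"
proof -
  define a where "a k = p ^ (k choose 2) / qpoch p p k" for k
  have choose_Suc: "Suc k choose 2 = (k choose 2) + k" for k
    by (simp add: numeral_2_eq_2)
  obtain K where K: "K > 0" "\<And>n. norm (1 / qpoch p p n) \<le> K"
    using inverse_qpoch_bounded[OF p] by blast
  have abs: "summable (\<lambda>k. norm (a k * y ^ k))" for y
  proof -
    \<comment> \<open>Successive terms of \<open>g\<close> have ratio
      \<open>norm p ^ k * norm y\<close>, which tends to 0, so the ratio test applies for every
      \<open>y\<close>.\<close>
    define g where "g k = norm p ^ (k choose 2) * norm y ^ k" for k
    have "(\<lambda>k. norm p ^ k * norm y) \<longlonglongrightarrow> 0 * norm y"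
      using p by (intro tendsto_mult_right LIMSEQ_realpow_zero) auto
    then have "eventually (\<lambda>k. norm p ^ k * norm y < 1/2) sequentially"
      by (intro order_tendstoD) auto
    then obtain N where N: "\<And>k. k \<ge> N \<Longrightarrow> norm p ^ k * norm y < 1/2"
      by (auto simp: eventually_sequentially)
    have "summable g"
    proof (rule summable_ratio_test)
      fix k assume "k \<ge> N"
      have "g (Suc k) = (norm p ^ k * norm y) * g k"
        by (simp add: g_def choose_Suc power_add)
      also have "\<dots> \<le> 1/2 * g k"
        using N[OF \<open>k \<ge> N\<close>] by (intro mult_right_mono) (auto simp: g_def)
      finally show "norm (g (Suc k)) \<le> 1/2 * norm (g k)"
        by (simp add: g_def)
    qed simp
    then have "summable (\<lambda>k. K * g k)" by (rule summable_mult)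
    moreover have "norm (norm (a k * y ^ k)) \<le> K * g k" for k
    proof -
      have "norm (a k * y ^ k) = norm (1 / qpoch p p k) * g k"
        by (simp add: a_def g_def norm_mult norm_divide norm_power)
      also have "\<dots> \<le> K * g k"
        using K by (intro mult_right_mono) (auto simp: g_def)
      finally show ?thesis by simp
    qed
    ultimately show ?thesis by (rule summable_comparison_test'[where N = 0])
  qed
  then have sm: "summable (\<lambda>k. a k * y ^ k)" for y
    by (rule summable_norm_cancel)
  define E where "E y = (\<Sum>k. a k * y ^ k)" for y
  have fe: "E y = (1 + y) * E (y * p)" for y
  proof -
    have "(\<lambda>k. y * (a k * (y * p) ^ k)) sums (y * E (y * p))"
      unfolding E_def by (intro sums_mult summable_sums sm)
    \<comment> \<open>This is the coefficient recurrence
      \<open>a (Suc k) * (1 - p ^ Suc k) = p ^ k * a k\<close>. The index shift that follows adds no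
      term, since \<open>1 - p ^ 0 = 0\<close>.\<close>
    moreover have "y * (a k * (y * p) ^ k) = a (Suc k) * y ^ Suc k * (1 - p ^ Suc k)" for k
      using qpoch_self_factor_nonzero[OF p, of k]
      by (simp add: a_def choose_Suc qpoch_Suc power_add power_mult_distrib)
    ultimately have "(\<lambda>k. a k * y ^ k * (1 - p ^ k)) sums (y * E (y * p))"
      using sums_Suc_iff[of "\<lambda>k. a k * y ^ k * (1 - p ^ k)"] by simp
    moreover have "(\<lambda>k. a k * y ^ k - a k * (y * p) ^ k) sums (E y - E (y * p))"
      unfolding E_def by (intro sums_diff summable_sums sm)
    ultimately have "E y - E (y * p) = y * E (y * p)"
      by (intro sums_unique2) (simp_all add: power_mult_distrib algebra_simps)
    then show ?thesis by (simp add: algebra_simps)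
  qed
  have iter: "E x = qpoch (- x) p n * E (x * p ^ n)" for n
  proof (induction n)
    case (Suc n)
    then show ?case
      using fe[of "x * p ^ n"] by (simp add: qpoch_Suc mult_ac)
  qed (simp add: qpoch_def)
  have "isCont E 0"
    unfolding E_def using sm[of 1] by (intro isCont_powser[where K = 1]) auto
  moreover have "(\<lambda>n. x * p ^ n) \<longlonglongrightarrow> x * 0"
    using p by (intro tendsto_mult_left LIMSEQ_power_zero) auto
  ultimately have "(\<lambda>n. E (x * p ^ n)) \<longlonglongrightarrow> E 0"
    using isCont_tendsto_compose[of 0 E "\<lambda>n. x * p ^ n"] by simp
  moreover have "E 0 = 1"
  proof -
    have "E 0 = a 0" unfolding E_def using powser_zero[of a] by simp
    then show ?thesis by (simp add: a_def qpoch_def numeral_2_eq_2)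
  qed
  ultimately have "(\<lambda>n. qpoch (- x) p n * E (x * p ^ n)) \<longlonglongrightarrow> qpoch_inf (- x) p * 1"
    by (intro tendsto_mult qpoch_LIMSEQ p) simp
  then have "E x = qpoch_inf (- x) p"
    using iter LIMSEQ_const_iff[of "E x"] by simp
  with sm[of x] have "(\<lambda>k. a k * x ^ k) sums qpoch_inf (- x) p"
    by (simp add: E_def sums_iff)
  with abs[of x] have "((\<lambda>k. a k * x ^ k) has_sum qpoch_inf (- x) p) UNIV"
    by (rule norm_summable_imp_has_sum)
  then show ?thesis by (simp add: a_def)
qed

section \<open>Real powers of q, theta series and the Jacobi triple product\<close>

lemma qpow_add: "qpow \<tau> (x + y) = qpow \<tau> x * qpow \<tau> y"
  by (simp add: qpow_def distrib_left exp_add)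

lemma qpow_0 [simp]: "qpow \<tau> 0 = 1"
  by (simp add: qpow_def)

lemma qpow_power: "qpow \<tau> x ^ n = qpow \<tau> (real n * x)"
  by (simp add: qpow_def mult_ac flip: exp_of_nat_mult)

lemma norm_qpow: "norm (qpow \<tau> x) = exp (- (2 * pi * Im \<tau> * x))"
  by (simp add: qpow_def)

lemma norm_qpow_less_1: "Im \<tau> > 0 \<Longrightarrow> x > 0 \<Longrightarrow> norm (qpow \<tau> x) < 1"
  by (simp add: norm_qpow)

lemma summable_on_exp_abs_int: "(\<lambda>d::int. exp (- \<bar>real_of_int d\<bar>)) summable_on UNIV"
proof -
  have "summable (\<lambda>n. exp (-1 :: real) ^ n)"
    by (intro summable_geometric) auto
  then have *: "(\<lambda>n::nat. exp (- real n)) summable_on UNIV"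
    by (intro summable_nonneg_imp_summable_on) (simp_all flip: exp_of_nat_mult)
  have "(\<lambda>d. exp (- \<bar>real_of_int d\<bar>)) summable_on range int"
    using * by (subst summable_on_reindex) (auto simp: o_def)
  moreover have "(\<lambda>d. exp (- \<bar>real_of_int d\<bar>)) summable_on range (\<lambda>n. - int n)"
    using * by (subst summable_on_reindex) (auto simp: o_def inj_on_def)
  ultimately have "(\<lambda>d. exp (- \<bar>real_of_int d\<bar>)) summable_on (range int \<union> range (\<lambda>n. - int n))"
    by (rule summable_on_union)
  moreover have "d \<in> range int \<union> range (\<lambda>n. - int n)" for d
    by (cases d rule: int_cases2) auto
  then have "range int \<union> range (\<lambda>n. - int n) = UNIV" by blast
  ultimately show ?thesis by simp
qed

lemma summable_on_qpow_quadratic: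
  assumes "Im \<tau> > 0" "a > 0"
  shows "(\<lambda>d::int. qpow \<tau> (a * (real_of_int d)\<^sup>2 + b * real_of_int d)) summable_on UNIV"
proof -
  define A where "A = 2 * pi * Im \<tau> * a"
  define B where "B = 2 * pi * Im \<tau> * b"
  \<comment> \<open>Completing the square shows that this is the least constant with \<open>A *
    x\<^sup>2 - (\<bar>B\<bar> + 1) * \<bar>x\<bar> + M \<ge> 0\<close> for all real
    \<open>x\<close>. The extra 1 leaves room for the majorant
    \<open>exp (- \<bar>x\<bar>)\<close>.\<close>
  define M where "M = (\<bar>B\<bar> + 1)\<^sup>2 / (4 * A)"
  have A: "A > 0" using assms by (simp add: A_def)
  have bound: "norm (qpow \<tau> (a * x\<^sup>2 + b * x)) \<le> exp M * exp (- \<bar>x\<bar>)" for x :: real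
  proof -
    have square: "(2 * A * y - c)\<^sup>2 = 4 * A * (A * y\<^sup>2 - c * y) + c\<^sup>2" for y c :: real
      by (simp add: power2_eq_square algebra_simps)
    have "0 \<le> (2 * A * \<bar>x\<bar> - (\<bar>B\<bar> + 1))\<^sup>2" by simp
    also have "\<dots> = 4 * A * (A * x\<^sup>2 - (\<bar>B\<bar> + 1) * \<bar>x\<bar> + M)"
      using A by (simp add: square M_def distrib_left)
    finally have "A * x\<^sup>2 - (\<bar>B\<bar> + 1) * \<bar>x\<bar> + M \<ge> 0"
      using A by (simp add: zero_le_mult_iff)
    moreover have "B * x \<ge> - (\<bar>B\<bar> * \<bar>x\<bar>)"
      by (metis abs_ge_minus_self abs_mult minus_le_iff)
    ultimately have "- (A * x\<^sup>2 + B * x) \<le> M - \<bar>x\<bar>"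
      by (simp add: algebra_simps)
    moreover have "norm (qpow \<tau> (a * x\<^sup>2 + b * x)) = exp (- (A * x\<^sup>2 + B * x))"
      by (simp add: norm_qpow A_def B_def algebra_simps)
    ultimately show ?thesis by (simp flip: exp_add)
  qed
  have "(\<lambda>d::int. exp M * exp (- \<bar>real_of_int d\<bar>)) summable_on UNIV"
    by (rule summable_on_cmult_right[OF summable_on_exp_abs_int])
  then show ?thesis
    by (rule abs_summable_summable[OF Infinite_Sum.abs_summable_on_comparison_test'[OF _ bound]])
qed

text \<open>The product of Euler's expansions at \<open>qpow \<tau> (a + b)\<close> and
  \<open>qpow \<tau> (a - b)\<close> is a double series that can be summed in two ways. Row by row
  it gives two of the three infinite products; along diagonals it gives the theta series divided by
  the third.\<close>

lemma jacobi_triple_product: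
  assumes \<tau>: "Im \<tau> > 0" and a: "a > 0"
  shows "((\<lambda>d::int. qpow \<tau> (a * (real_of_int d)\<^sup>2 + b * real_of_int d)) has_sum
           qpoch_inf_list [- qpow \<tau> (a + b), - qpow \<tau> (a - b), qpow \<tau> (2 * a)] (qpow \<tau> (2 * a))) UNIV"
proof -
  define p where "p = qpow \<tau> (2 * a)"
  define c where "c = (\<lambda>d::int. qpow \<tau> (a * (real_of_int d)\<^sup>2 + b * real_of_int d))"
  define e where "e = (\<lambda>x i. p ^ (i choose 2) * x ^ i / qpoch p p i)"
  let ?X = "qpow \<tau> (a + b)" and ?Y = "qpow \<tau> (a - b)"
  have p: "norm p < 1" using assms by (simp add: p_def norm_qpow_less_1)
  have e_sum: "(e x has_sum qpoch_inf (- x) p) UNIV" for x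
    unfolding e_def by (rule euler_qexp[OF p])
  have c: "(c has_sum infsum c UNIV) UNIV"
    using summable_on_qpow_quadratic[OF assms, of b] by (simp add: c_def)
  have real_choose: "real (i choose 2) = real i * (real i - 1) / 2" for i
    by (induction i) (simp_all add: numeral_2_eq_2 field_simps)
  have "e ?X i * e ?Y j = c (int i - int j) * durfee_term p i j" for i j
  proof -
    \<comment> \<open>The linear terms of the binomial coefficients cancel
      \<open>a * (i + j)\<close>, and
      \<open>i\<^sup>2 + j\<^sup>2 = (i - j)\<^sup>2 + 2 * i * j\<close> separates the theta weight
      from the Durfee weight in base \<open>p\<close>.\<close>
    have "p ^ (i choose 2) * ?X ^ i * (p ^ (j choose 2) * ?Y ^ j) = c (int i - int j) * p ^ (i * j)"
      unfolding p_def c_def qpow_power qpow_add[symmetric]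
      by (rule arg_cong[where f = "qpow \<tau>"]) (simp add: real_choose power2_eq_square field_simps)
    then show ?thesis by (simp add: e_def durfee_term_def)
  qed
  then have "((\<lambda>(i, j). e ?X i * e ?Y j) has_sum (infsum c UNIV / qpoch_inf p p)) (UNIV \<times> UNIV)"
    using has_sum_durfee_weighted[OF p c] by simp
  then have "((\<lambda>i. e ?X i * qpoch_inf (- ?Y) p) has_sum (infsum c UNIV / qpoch_inf p p)) UNIV"
    by (rule has_sum_SigmaD) (simp only: prod.case, rule has_sum_cmult_right[OF e_sum])
  moreover have "((\<lambda>i. e ?X i * qpoch_inf (- ?Y) p) has_sum
      (qpoch_inf (- ?X) p * qpoch_inf (- ?Y) p)) UNIV"
    by (intro has_sum_cmult_left e_sum)
  ultimately have "infsum c UNIV / qpoch_inf p p = qpoch_inf (- ?X) p * qpoch_inf (- ?Y) p"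
    by (rule has_sum_unique)
  then have "infsum c UNIV = qpoch_inf_list [- ?X, - ?Y, p] p"
    using qpoch_inf_self_nonzero[OF p] by (simp add: qpoch_inf_list_def field_simps)
  with c show ?thesis by (simp add: c_def p_def)
qed

section \<open>Product simplifications and parity reductions\<close>

text \<open>The factor at \<open>k = 0\<close> is 2 and the others are those of
  \<open>qpoch_inf (- p) p\<close>, shifted by one. The parameter \<open>- 1\<close> arises when the
  triple product is used with \<open>b = a\<close>.\<close>

lemma qpoch_inf_minus_1: "norm p < 1 \<Longrightarrow> qpoch_inf (- 1) p = 2 * qpoch_inf (- p) p"
proof -
  assume p: "norm p < 1"
  have "qpoch (- 1) p (Suc n) = 2 * qpoch (- p) p n" for n
  proof (induction n)
    case (Suc n)
    then show ?case by (subst qpoch_Suc) (simp add: qpoch_Suc[of "- p"])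
  qed (simp add: qpoch_def)
  moreover have "(\<lambda>n. qpoch (- 1) p (Suc n)) \<longlonglongrightarrow> qpoch_inf (- 1) p"
    by (rule LIMSEQ_Suc[OF qpoch_LIMSEQ[OF p]])
  moreover have "(\<lambda>n. 2 * qpoch (- p) p n) \<longlonglongrightarrow> 2 * qpoch_inf (- p) p"
    by (intro tendsto_intros qpoch_LIMSEQ p)
  ultimately show ?thesis by (auto intro: LIMSEQ_unique)
qed

text \<open>Factor by factor this is a difference of squares. It produces the base
  \<open>q^(8 \<alpha>)\<close> from \<open>q^(4 \<alpha>)\<close>.\<close>

lemma qpoch_inf_square_base:
  assumes p: "norm p < 1"
  shows "qpoch_inf (- p) p * qpoch_inf p p = qpoch_inf (p\<^sup>2) (p\<^sup>2)"
proof -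
  have "(\<lambda>n. qpoch (- p) p n * qpoch p p n) = qpoch (p\<^sup>2) (p\<^sup>2)"
    unfolding qpoch_def prod.distrib[symmetric]
    by (intro ext prod.cong refl) (simp add: power2_eq_square power_mult_distrib algebra_simps)
  moreover have "(\<lambda>n. qpoch (- p) p n * qpoch p p n) \<longlonglongrightarrow> qpoch_inf (- p) p * qpoch_inf p p"
    by (intro tendsto_intros qpoch_LIMSEQ p)
  moreover have "qpoch (p\<^sup>2) (p\<^sup>2) \<longlonglongrightarrow> qpoch_inf (p\<^sup>2) (p\<^sup>2)"
    using p by (intro qpoch_LIMSEQ) (simp add: norm_power power_less_one_iff)
  ultimately show ?thesis by (auto intro: LIMSEQ_unique)
qed

lemma has_sum_odd_int:
  fixes g :: "int \<Rightarrow> complex"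
  assumes "((\<lambda>r. g (2 * r + 1)) has_sum S) UNIV"
  shows "((\<lambda>d. if odd d then g d else 0) has_sum S) UNIV"
proof -
  have "(g has_sum S) {d. odd d}"
    using assms
    by (subst (asm) has_sum_reindex_bij_witness[where i = "\<lambda>d. (d - 1) div 2" and
          j = "\<lambda>r. 2 * r + 1" and T = "{d. odd d}" and h = g and s' = S]) auto
  then show ?thesis
    by (subst (asm) has_sum_cong_neutral[where T = UNIV and g = "\<lambda>d. if odd d then g d else 0"]) auto
qed

text \<open>The support consists of the pairs with exactly one odd entry. Swapping the entries
  exchanges the odd-even pairs with the even-odd ones, so each class carries half of the
  sum.\<close>

lemma has_sum_odd_even_half:
  fixes f :: "nat \<times> nat \<Rightarrow> complex"
  assumes f: "(f has_sum S) UNIV"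
    and sym: "\<And>m n. f (m, n) = f (n, m)"
    and even_0: "\<And>m n. even (m + n) \<Longrightarrow> f (m, n) = 0"
  shows "((\<lambda>(i, j). f (2 * i + 1, 2 * j)) has_sum (S / 2)) UNIV"
proof -
  have odd_sum: "odd (m + n)" if "f (m, n) \<noteq> 0" for m n
    using even_0 that by blast
  define A where "A = {(m::nat, n::nat). odd m \<and> even n}"
  define B where "B = {(m::nat, n::nat). even m \<and> odd n}"
  obtain s where A: "(f has_sum s) A"
    using summable_on_subset[OF has_sum_imp_summable[OF f], of A] has_sum_infsum by blast
  moreover have "(f has_sum s) A \<longleftrightarrow> (f has_sum s) B"
    by (rule has_sum_reindex_bij_witness[where i = prod.swap and j = prod.swap])
       (auto simp: A_def B_def sym)
  ultimately have "(f has_sum (s + s)) (A \<union> B)"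
    by (intro has_sum_Un_disjoint) (auto simp: A_def B_def)
  then have "(f has_sum (s + s)) UNIV"
    by (subst (asm) has_sum_cong_neutral[where T = UNIV and g = f])
       (auto simp: A_def B_def dest!: odd_sum)
  with f have "s = S / 2" using has_sum_unique by fastforce
  moreover have "((\<lambda>(i, j). f (2 * i + 1, 2 * j)) has_sum s) UNIV \<longleftrightarrow> (f has_sum s) A"
    by (rule has_sum_reindex_bij_witness[where i = "\<lambda>(m, n). (m div 2, n div 2)" and
          j = "\<lambda>(i, j). (2 * i + 1, 2 * j)"]) (auto simp: A_def)
  ultimately show ?thesis using A by (simp only:)
qed

section \<open>The two double-sum identities\<close>

lemma has_sum_odd_int_jacobi:
  assumes "Im \<tau> > 0" "\<alpha> > 0"
    and "\<And>r. g (2 * r + 1) = qpow \<tau> (2 * \<alpha> * (real_of_int r)\<^sup>2 + b * real_of_int r)"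
  shows "((\<lambda>d. if odd d then g d else 0) has_sum
     qpoch_inf_list [- qpow \<tau> (2 * \<alpha> + b), - qpow \<tau> (2 * \<alpha> - b), qpow \<tau> (4 * \<alpha>)] (qpow \<tau> (4 * \<alpha>))) UNIV"
  using jacobi_triple_product[of \<tau> "2 * \<alpha>" b] assms by (intro has_sum_odd_int) simp

text \<open>With \<open>m = 2 * i + 1\<close>, \<open>n = 2 * j\<close> and
  \<open>d = m - n\<close>, the exponent equals
  \<open>\<alpha> * (d\<^sup>2 - 1) / 2 + m * n\<close>, so the summand is a weight in
  \<open>d\<close> times a Durfee term.\<close>

lemma has_sum_odd_even_square_quotient:
  assumes \<tau>: "Im \<tau> > 0" and \<alpha>: "\<alpha> > 0" and q_def: "q = qpow \<tau> 1"
  shows "((\<lambda>(i::nat, j::nat).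
            qpow \<tau> (2 * \<alpha> * (real i)\<^sup>2 + 4 * (1 - \<alpha>) * real i * real j + 2 * \<alpha> * (real j)\<^sup>2
                     + 2 * \<alpha> * real i + (2 - 2 * \<alpha>) * real j)
            / (qpoch q q (2 * i + 1) * qpoch q q (2 * j)))
          has_sum
            ((qpoch_inf (qpow \<tau> (8 * \<alpha>)) (qpow \<tau> (8 * \<alpha>)))\<^sup>2
             / (qpoch_inf q q * qpoch_inf (qpow \<tau> (4 * \<alpha>)) (qpow \<tau> (4 * \<alpha>))))) UNIV"
proof -
  define p where "p = qpow \<tau> (4 * \<alpha>)"
  define g where "g d = qpow \<tau> (\<alpha> * ((real_of_int d)\<^sup>2 - 1) / 2)" for d
  define f where "f = (\<lambda>(m, n). (if odd (int m - int n) then g (int m - int n) else 0) * durfee_term q m n)"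
  have q: "norm q < 1" using \<tau> by (simp add: q_def norm_qpow_less_1)
  have p: "norm p < 1" using \<tau> \<alpha> by (simp add: p_def norm_qpow_less_1)
  have g_odd: "g (2 * r + 1) = qpow \<tau> (2 * \<alpha> * (real_of_int r)\<^sup>2 + 2 * \<alpha> * real_of_int r)" for r
    unfolding g_def by (rule arg_cong[where f = "qpow \<tau>"]) (simp add: power2_eq_square field_simps)
  have "((\<lambda>d. if odd d then g d else 0) has_sum qpoch_inf_list [- p, - 1, p] p) UNIV"
    using has_sum_odd_int_jacobi[OF \<tau> \<alpha> g_odd] by (simp add: p_def)
  then have "(f has_sum (qpoch_inf_list [- p, - 1, p] p / qpoch_inf q q)) UNIV"
    unfolding f_def by (rule has_sum_durfee_weighted[OF q])
  then have "((\<lambda>(i, j). f (2 * i + 1, 2 * j)) has_sum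
      (qpoch_inf_list [- p, - 1, p] p / qpoch_inf q q / 2)) UNIV"
    by (rule has_sum_odd_even_half)
       (auto simp: f_def g_def durfee_term_def power2_commute mult_ac)
  moreover have "f (2 * i + 1, 2 * j) =
      qpow \<tau> (2 * \<alpha> * (real i)\<^sup>2 + 4 * (1 - \<alpha>) * real i * real j + 2 * \<alpha> * (real j)\<^sup>2
                     + 2 * \<alpha> * real i + (2 - 2 * \<alpha>) * real j)
            / (qpoch q q (2 * i + 1) * qpoch q q (2 * j))" for i j
  proof -
    have "g (int (2 * i + 1) - int (2 * j)) * q ^ ((2 * i + 1) * (2 * j)) =
        qpow \<tau> (2 * \<alpha> * (real i)\<^sup>2 + 4 * (1 - \<alpha>) * real i * real j + 2 * \<alpha> * (real j)\<^sup>2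
                     + 2 * \<alpha> * real i + (2 - 2 * \<alpha>) * real j)"
      unfolding g_def q_def qpow_power qpow_add[symmetric]
      by (rule arg_cong[where f = "qpow \<tau>"]) (simp add: power2_eq_square field_simps)
    then show ?thesis by (simp add: f_def durfee_term_def)
  qed
  \<comment> \<open>The parameter \<open>- 1\<close> gives \<open>2 * qpoch_inf (- p) p\<close>,
    whose 2 cancels the halving. Extending the fraction by \<open>qpoch_inf p p\<close> completes
    the square of \<open>qpoch_inf (p\<^sup>2) (p\<^sup>2)\<close>.\<close>
  moreover have "qpoch_inf_list [- p, - 1, p] p / qpoch_inf q q / 2 =
      (qpoch_inf (p\<^sup>2) (p\<^sup>2))\<^sup>2 / (qpoch_inf q q * qpoch_inf p p)"
    unfolding qpoch_inf_square_base[OF p, symmetric]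
    using qpoch_inf_self_nonzero[OF p]
    by (simp add: qpoch_inf_list_def qpoch_inf_minus_1[OF p] power2_eq_square)
  moreover have "p\<^sup>2 = qpow \<tau> (8 * \<alpha>)"
    by (simp add: p_def qpow_power)
  ultimately show ?thesis by (simp add: p_def)
qed

text \<open>Here the exponent leaves \<open>m * n - n\<close> in place of \<open>m * n\<close>, so
  the summand is not itself a weighted Durfee term. It splits into two such terms, the second with
  \<open>n\<close> lowered by one. Each has total \<open>J / qpoch_inf q q\<close>, and the halving
  by symmetry compensates the doubling.\<close>

lemma has_sum_odd_even_triple_product:
  assumes \<tau>: "Im \<tau> > 0" and \<alpha>: "\<alpha> > 0" and q_def: "q = qpow \<tau> 1"
  shows "((\<lambda>(i::nat, j::nat).
            qpow \<tau> (2 * \<alpha> * (real i)\<^sup>2 + 4 * (1 - \<alpha>) * real i * real j + 2 * \<alpha> * (real j)\<^sup>2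
                     + (2 * \<alpha> - 1) * (real i - real j))
            / (qpoch q q (2 * i + 1) * qpoch q q (2 * j)))
          has_sum
            (qpoch_inf_list [- q, - qpow \<tau> (4 * \<alpha> - 1), qpow \<tau> (4 * \<alpha>)] (qpow \<tau> (4 * \<alpha>))
             / qpoch_inf q q)) UNIV"
proof -
  define J where "J = qpoch_inf_list [- qpow \<tau> (4 * \<alpha> - 1), - q, qpow \<tau> (4 * \<alpha>)] (qpow \<tau> (4 * \<alpha>))"
  define g where "g d = qpow \<tau> (\<alpha> * ((real_of_int d)\<^sup>2 - 1) / 2 + (1 - real_of_int d) / 2)" for d
  define c where "c = (\<lambda>d. if odd d then g d else 0)"
  \<comment> \<open>The exponent \<open>m * n - n\<close> is negative for \<open>m = 0\<close> and
    \<open>n > 0\<close>, hence \<open>qpow\<close> in place of a natural power.\<close>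
  define f where "f = (\<lambda>(m, n). c (int m - int n) * qpow \<tau> (real m * real n - real n)
      / (qpoch q q m * qpoch q q n))"
  define h1 where "h1 = (\<lambda>(m, n). c (int m - int n) * durfee_term q m n)"
  \<comment> \<open>Lowering \<open>n\<close> by one turns the difference \<open>d\<close> into
    \<open>d + 1\<close>, so the weight evaluated there is \<open>c (- d)\<close>, which equals
    \<open>c d * q^d\<close>. The reflection \<open>1 - d\<close> permutes the integers and
    preserves the sum of \<open>c\<close>.\<close>
  define h2 where "h2 = (\<lambda>(m, n). c (1 - (int m - int n)) * durfee_term q m n)"
  define h2' where "h2' = (\<lambda>(m, n). if n = 0 then 0 else h2 (m, n - 1))"
  have q: "norm q < 1" using \<tau> by (simp add: q_def norm_qpow_less_1)
  have g_odd: "g (2 * r + 1) = qpow \<tau> (2 * \<alpha> * (real_of_int r)\<^sup>2 + (2 * \<alpha> - 1) * real_of_int r)" for r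
    unfolding g_def by (rule arg_cong[where f = "qpow \<tau>"]) (simp add: power2_eq_square field_simps)
  have c: "(c has_sum J) UNIV"
    using has_sum_odd_int_jacobi[OF \<tau> \<alpha> g_odd] by (simp add: J_def c_def q_def)
  have c': "((\<lambda>d. c (1 - d)) has_sum J) UNIV"
    using c by (subst has_sum_reindex_bij_witness[where i = "\<lambda>d. 1 - d" and j = "\<lambda>d. 1 - d"
      and T = UNIV and h = c and s' = J]) auto
  have "(h1 has_sum (J / qpoch_inf q q)) UNIV"
    unfolding h1_def by (rule has_sum_durfee_weighted[OF q c])
  moreover have "(h2' has_sum (J / qpoch_inf q q)) UNIV"
  proof -
    have "(h2 has_sum (J / qpoch_inf q q)) UNIV"
      unfolding h2_def by (rule has_sum_durfee_weighted[OF q c'])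
    also have "?this \<longleftrightarrow> (h2' has_sum (J / qpoch_inf q q)) {(m, n). n > 0}"
      by (rule has_sum_reindex_bij_witness[where i = "\<lambda>(m, n). (m, n - 1)" and
            j = "\<lambda>(m, n). (m, Suc n)"]) (auto simp: h2'_def)
    also have "\<dots> \<longleftrightarrow> (h2' has_sum (J / qpoch_inf q q)) UNIV"
      by (rule has_sum_cong_neutral) (auto simp: h2'_def)
    finally show ?thesis .
  qed
  ultimately have "((\<lambda>x. h1 x + h2' x) has_sum (J / qpoch_inf q q + J / qpoch_inf q q)) UNIV"
    by (rule has_sum_add)
  moreover have "f x = h1 x + h2' x" for x
  proof -
    obtain m n where x: "x = (m, n)" by fastforce
    show ?thesis
    proof (cases n)
      case 0
      then show ?thesis by (simp add: x f_def h1_def h2'_def durfee_term_def)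
    next
      case (Suc k)
      \<comment> \<open>\<open>q\<^sup>-\<^sup>n = 1 + q\<^sup>-\<^sup>n (1 - q\<^sup>n)\<close>, and \<open>1 - q\<^sup>n\<close> cancels the last factor of \<open>(q; q)\<^sub>n\<close>.\<close>
      define d where "d = int m - int n"
      define B where "B = qpow \<tau> (real_of_int d)"
      have "c (1 - (int m - int k)) = c (- d)"
        by (simp add: d_def Suc algebra_simps)
      also have "\<dots> = c d * B"
        by (simp add: c_def g_def B_def field_simps flip: qpow_add)
      finally have c2: "c (1 - (int m - int k)) = c d * B" .
      have qm: "q ^ m = q ^ Suc k * B"
        unfolding q_def qpow_power B_def qpow_add[symmetric] by (simp add: d_def Suc)
      have e: "qpow \<tau> (real m * real n - real n) = q ^ (m * k) * B"
        unfolding q_def qpow_power B_def qpow_add[symmetric] by (simp add: d_def Suc algebra_simps)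
      have nz: "1 - q * q ^ k \<noteq> 0" "qpoch q q k \<noteq> 0" "qpoch q q m \<noteq> 0"
        using qpoch_self_factor_nonzero[OF q] qpoch_self_nonzero[OF q] by auto
      define D where "D = qpoch q q m * (qpoch q q k * (1 - q * q ^ k))"
      have "h1 x = c d * (q ^ m * q ^ (m * k)) / D"
        by (simp add: x h1_def d_def D_def durfee_term_def Suc power_add qpoch_Suc)
      moreover have "h2' x = c d * (q ^ (m * k) * B) * (1 - q * q ^ k) / D"
        using nz by (simp add: x h2'_def h2_def c2 Suc durfee_term_def D_def)
      moreover have "f x = c d * (q ^ (m * k) * B) / D"
        by (simp add: x f_def e flip: d_def) (simp add: Suc qpoch_Suc D_def)
      moreover have "c d * (q ^ m * q ^ (m * k)) + c d * (q ^ (m * k) * B) * (1 - q * q ^ k)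
          = c d * (q ^ (m * k) * B)"
        unfolding qm by (simp add: algebra_simps)
      ultimately show ?thesis
        by (simp only: add_divide_distrib[symmetric])
    qed
  qed
  then have "f = (\<lambda>x. h1 x + h2' x)" by (rule ext)
  ultimately have "(f has_sum (2 * (J / qpoch_inf q q))) UNIV"
    by (simp only: mult_2)
  then have "((\<lambda>(i, j). f (2 * i + 1, 2 * j)) has_sum (2 * (J / qpoch_inf q q) / 2)) UNIV"
  proof (rule has_sum_odd_even_half)
    \<comment> \<open>The linear parts combine to \<open>m * n + (1 - m - n) / 2\<close>, which is
      symmetric although neither factor is.\<close>
    fix m n :: nat
    have "g (int m - int n) * qpow \<tau> (real m * real n - real n)
        = g (int n - int m) * qpow \<tau> (real n * real m - real m)"
      unfolding g_def qpow_add[symmetric]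
      by (rule arg_cong[where f = "qpow \<tau>"]) (simp add: power2_eq_square field_simps)
    then show "f (m, n) = f (n, m)"
      by (simp add: f_def c_def mult_ac)
  qed (simp add: f_def c_def)
  moreover have "f (2 * i + 1, 2 * j) =
      qpow \<tau> (2 * \<alpha> * (real i)\<^sup>2 + 4 * (1 - \<alpha>) * real i * real j + 2 * \<alpha> * (real j)\<^sup>2
                     + (2 * \<alpha> - 1) * (real i - real j))
            / (qpoch q q (2 * i + 1) * qpoch q q (2 * j))" for i j
  proof -
    have "g (int (2 * i + 1) - int (2 * j)) * qpow \<tau> (real (2 * i + 1) * real (2 * j) - real (2 * j)) =
        qpow \<tau> (2 * \<alpha> * (real i)\<^sup>2 + 4 * (1 - \<alpha>) * real i * real j + 2 * \<alpha> * (real j)\<^sup>2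
                     + (2 * \<alpha> - 1) * (real i - real j))"
      unfolding g_def qpow_add[symmetric]
      by (rule arg_cong[where f = "qpow \<tau>"]) (simp add: power2_eq_square field_simps)
    then show ?thesis by (simp add: f_def c_def)
  qed
  ultimately show ?thesis by (simp add: J_def qpoch_inf_list_def mult_ac)
qed

theorem theorem5p10:
  fixes \<tau> q :: complex and \<alpha> :: real
  assumes "Im \<tau> > 0"
    and "q = exp (2 * of_real pi * \<i> * \<tau>)"
    and "\<alpha> > 0"
  shows "((\<lambda>(i::nat, j::nat).
            qpow \<tau> (2 * \<alpha> * (real i)\<^sup>2 + 4 * (1 - \<alpha>) * real i * real j + 2 * \<alpha> * (real j)\<^sup>2
                     + (2 * \<alpha> - 1) * (real i - real j))
            / (qpoch q q (2 * i + 1) * qpoch q q (2 * j)))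
          has_sum
            (qpoch_inf_list [- q, - qpow \<tau> (4 * \<alpha> - 1), qpow \<tau> (4 * \<alpha>)] (qpow \<tau> (4 * \<alpha>))
             / qpoch_inf q q)) UNIV
       \<and> ((\<lambda>(i::nat, j::nat).
            qpow \<tau> (2 * \<alpha> * (real i)\<^sup>2 + 4 * (1 - \<alpha>) * real i * real j + 2 * \<alpha> * (real j)\<^sup>2
                     + 2 * \<alpha> * real i + (2 - 2 * \<alpha>) * real j)
            / (qpoch q q (2 * i + 1) * qpoch q q (2 * j)))
          has_sum
            ((qpoch_inf (qpow \<tau> (8 * \<alpha>)) (qpow \<tau> (8 * \<alpha>)))\<^sup>2
             / (qpoch_inf q q * qpoch_inf (qpow \<tau> (4 * \<alpha>)) (qpow \<tau> (4 * \<alpha>))))) UNIV"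
proof -
  have "q = qpow \<tau> 1"
    using assms(2) by (simp add: qpow_def)
  then show ?thesis
    using assms(1,3)
    by (intro conjI has_sum_odd_even_triple_product has_sum_odd_even_square_quotient)
qed

end
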